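(* Let $n\ge 4$ and let $\mathcal{S}_n$ be the set of integer solutions, identified up to permutation of coordinates, of $\left(\sum_i x_i\right)^2-\sum_i x_i-4\sum_{1\le i<j\le n}x_ix_j=0$, viewed as a graph with two elements adjacent if (for suitable orderings) they differ in exactly one coordinate. Let $\mathcal{S}_n^+$ and $\mathcal{S}_n^-$ be the sets of elements $\mathbf{x}$ with $\sum_i x_i+1>0$ and $\sum_i x_i+1<0$ respectively. Then each of $\mathcal{S}_n^+$ and $\mathcal{S}_n^-$ has infinitely many connected components.
   Context: Every element of $\mathcal{S}_n$ satisfies $\sum_i x_i+1\neq 0$, and adjacent elements lie in the same one of $\mathcal{S}_n^{\pm}$, so each of $\mathcal{S}_n^{\pm}$ is a union of components of $\mathcal{S}_n$. *)

theory Defs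
  imports Main "HOL-Library.Multiset"
begin

definition is_solution :: "int list \<Rightarrow> bool" where
  "is_solution xs \<longleftrightarrow>
     (sum_list xs)\<^sup>2 - sum_list xs
       - 4 * (\<Sum>(i, j) \<in> {(i, j). i < j \<and> j < length xs}. xs ! i * xs ! j) = 0"

text \<open>A tuple up to permutation of its coordinates is the multiset of its coordinates;
  the lists \<open>xs\<close> with \<open>mset xs = X\<close> are the orderings of \<open>X\<close>.\<close>

definition solutions :: "nat \<Rightarrow> int multiset set" where
  "solutions n = mset ` {xs. length xs = n \<and> is_solution xs}"

definition adjacent :: "int multiset \<Rightarrow> int multiset \<Rightarrow> bool" where
  "adjacent X Y \<longleftrightarrow>
     (\<exists>xs ys. mset xs = X \<and> mset ys = Y \<and> length xs = length ys \<and>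
        (\<exists>!i. i < length xs \<and> xs ! i \<noteq> ys ! i))"

definition solutions_pos :: "nat \<Rightarrow> int multiset set" where
  "solutions_pos n = {X \<in> solutions n. sum_mset X + 1 > 0}"

definition solutions_neg :: "nat \<Rightarrow> int multiset set" where
  "solutions_neg n = {X \<in> solutions n. sum_mset X + 1 < 0}"

text \<open>Vertex sets of the connected components of the graph induced on \<open>V\<close> by adjacency.
  The intersection with \<open>V \<times> V\<close> inside the closure keeps paths in \<open>V\<close>.\<close>

definition connected_components :: "int multiset set \<Rightarrow> int multiset set set" where
  "connected_components V = V // (({(X, Y). adjacent X Y} \<inter> V \<times> V)\<^sup>* \<inter> V \<times> V)"

end

theory Submission
  imports Defs
begin

text \<open>
  Put \<open>u = 2 (\<Sum>x) + 1\<close>. The equation becomes \<open>8 (\<Sum>x\<^sup>2) + 1 = u\<^sup>2\<close>, and the only other value which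
  may replace a coordinate \<open>x\<close> is \<open>u - 3 x\<close>. Such a move lowers \<open>\<Sum>x\<^sup>2\<close> iff
  \<open>(u - 2 x) (u - 4 x) < 0\<close>, which forces \<open>u\<^sup>2 < 16 x\<^sup>2\<close>; two coordinates with this property would
  contradict \<open>8 (\<Sum>x\<^sup>2) < u\<^sup>2\<close>. So every solution has at most one neighbour below it, and a connected
  component contains at most one solution without lower neighbours. The solutions
  \<open>(-m, m, 2 m\<^sup>2, 2 m\<^sup>2, 0, \<dots>, 0)\<close> and \<open>(m, -m - 1, -N, -N, 0, \<dots>, 0)\<close> with \<open>N = 2 m\<^sup>2 + 2 m + 1\<close> have
  none.
\<close>

section \<open>The equation in terms of the sum and the sum of squares\<close>

lemma square_sum_lessThan:
  fixes f :: "nat \<Rightarrow> 'a::comm_ring_1"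
  shows "(\<Sum>i<n. f i)\<^sup>2 =
    (\<Sum>i<n. (f i)\<^sup>2) + 2 * (\<Sum>(i, j) \<in> {(i, j). i < j \<and> j < n}. f i * f j)"
proof (induction n)
  case 0
  show ?case by simp
next
  case (Suc n)
  have fin: "finite {(i, j). i < j \<and> j < n}"
    by (rule finite_subset[of _ "{..<n} \<times> {..<n}"]) auto
  have "{(i, j). i < j \<and> j < Suc n} = {(i, j). i < j \<and> j < n} \<union> (\<lambda>i. (i, n)) ` {..<n}"
    by auto
  moreover have "{(i, j). i < j \<and> j < n} \<inter> (\<lambda>i. (i, n)) ` {..<n} = {}"
    by auto
  ultimately have "(\<Sum>(i, j) \<in> {(i, j). i < j \<and> j < Suc n}. f i * f j) =
      (\<Sum>(i, j) \<in> {(i, j). i < j \<and> j < n}. f i * f j)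
      + (\<Sum>(i, j) \<in> (\<lambda>i. (i, n)) ` {..<n}. f i * f j)"
    using fin by (simp add: sum.union_disjoint)
  also have "(\<Sum>(i, j) \<in> (\<lambda>i. (i, n)) ` {..<n}. f i * f j) = (\<Sum>i<n. f i) * f n"
    by (subst sum.reindex) (auto simp: inj_on_def sum_distrib_right)
  finally show ?case
    using Suc by (simp add: power2_sum algebra_simps)
qed

lemma sum_mset_squares_nonneg: "0 \<le> (\<Sum>x\<in>#X. (x::int)\<^sup>2)"
  by (induction X) auto

definition disc :: "int multiset \<Rightarrow> int" where
  "disc X = 2 * sum_mset X + 1"

text \<open>With sum s and sum of squares q, the pair sum is (s^2 - q)/2, so the equation reads 2q =
  s^2 + s; completing the square gives this form.\<close>

definition quadric :: "int multiset \<Rightarrow> bool" where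
  "quadric X \<longleftrightarrow> 8 * (\<Sum>x\<in>#X. x\<^sup>2) + 1 = (disc X)\<^sup>2"

lemma is_solution_iff_quadric: "is_solution xs \<longleftrightarrow> quadric (mset xs)"
proof -
  have s: "sum_list xs = (\<Sum>i<length xs. xs ! i)"
    by (simp add: sum_list_sum_nth atLeast0LessThan)
  have q: "(\<Sum>x\<in>#mset xs. x\<^sup>2) = (\<Sum>i<length xs. (xs ! i)\<^sup>2)"
    by (metis (no_types, lifting) atLeast0LessThan length_map lessThan_iff mset_map nth_map
        sum.cong sum_list_sum_nth sum_mset_sum_list)
  show ?thesis
    using square_sum_lessThan[of "(!) xs" "length xs"]
    unfolding is_solution_def quadric_def disc_def sum_mset_sum_list q s
    by (auto simp: power2_eq_square algebra_simps)
qed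

lemma solutions_eq: "solutions n = {X. size X = n \<and> quadric X}"
proof (intro equalityI subsetI)
  fix X assume "X \<in> {X. size X = n \<and> quadric X}"
  moreover obtain xs where "mset xs = X" using ex_mset by blast
  ultimately show "X \<in> solutions n"
    by (auto simp: solutions_def is_solution_iff_quadric)
qed (auto simp: solutions_def is_solution_iff_quadric)

section \<open>Exchanging one coordinate\<close>

lemma adjacentE:
  assumes "adjacent X Y"
  obtains x y M where "X = add_mset x M" "Y = add_mset y M" "x \<noteq> y"
proof -
  obtain xs ys i where X: "mset xs = X" and Y: "mset ys = Y" and len: "length xs = length ys"
    and i: "i < length xs" "xs ! i \<noteq> ys ! i"
    and uniq: "\<And>j. j < length xs \<Longrightarrow> xs ! j \<noteq> ys ! j \<Longrightarrow> j = i"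
    using assms unfolding adjacent_def by blast
  have "ys = xs[i := ys ! i]"
  proof (rule nth_equalityI)
    fix j assume "j < length ys"
    then show "ys ! j = xs[i := ys ! i] ! j"
      using len uniq[of j] by (cases "j = i") (auto simp: eq_commute)
  qed (simp add: len)
  then have "Y = add_mset (ys ! i) (X - {#xs ! i#})"
    using X Y i(1) by (metis mset_update)
  moreover have "X = add_mset (xs ! i) (X - {#xs ! i#})"
    using X i(1) by auto
  ultimately show thesis using that i(2) by blast
qed

text \<open>Vieta: for fixed \<open>M\<close> the equation is quadratic in the remaining coordinate,
  and its two roots add up to \<open>disc (add_mset x M) - 2 * x\<close>.\<close>

lemma quadric_replace:
  assumes "quadric (add_mset x M)" "quadric (add_mset y M)" "x \<noteq> y"
  shows "y = disc (add_mset x M) - 3 * x"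
proof -
  define u where "u = disc (add_mset x M)"
  have "disc (add_mset y M) = u + 2 * (y - x)"
    by (simp add: u_def disc_def)
  then have "8 * (y\<^sup>2 - x\<^sup>2) = (u + 2 * (y - x))\<^sup>2 - u\<^sup>2"
    using assms(1,2) unfolding quadric_def u_def[symmetric] by simp
  then have "4 * (y - x) * (u - 3 * x - y) = 0"
    by (simp add: power2_eq_square algebra_simps)
  then show ?thesis using assms(3) by (simp add: u_def)
qed

text \<open>A move that lowers the sum of squares; \<open>M\<close> contributes equally to both
  sides.\<close>

definition descends :: "int multiset \<Rightarrow> int multiset \<Rightarrow> bool" where
  "descends X Y \<longleftrightarrow> quadric X \<and> quadric Y \<and>
     (\<exists>x y M. X = add_mset x M \<and> Y = add_mset y M \<and> y\<^sup>2 < x\<^sup>2)"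

text \<open>A tie would force y = -x, hence \<open>disc X = 2 * x\<close>, but \<open>disc X\<close>
  is odd.\<close>

lemma adjacent_descends:
  assumes "adjacent X Y" "quadric X" "quadric Y"
  shows "descends X Y \<or> descends Y X"
proof -
  obtain x y M where X: "X = add_mset x M" and Y: "Y = add_mset y M" and "x \<noteq> y"
    using assms(1) by (rule adjacentE)
  then have y: "y = disc X - 3 * x" using quadric_replace assms by blast
  have "y \<noteq> - x"
  proof
    assume "y = - x"
    then have "disc X = 2 * x" using y by simp
    then show False unfolding disc_def by presburger
  qed
  then have "y\<^sup>2 \<noteq> x\<^sup>2" using \<open>x \<noteq> y\<close> by (auto simp: power2_eq_iff)
  then consider "y\<^sup>2 < x\<^sup>2" | "x\<^sup>2 < y\<^sup>2" by linarith
  then show ?thesis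
  proof cases
    case 1
    then have "descends X Y" unfolding descends_def using X Y assms(2,3) by blast
    then show ?thesis ..
  next
    case 2
    then have "descends Y X" unfolding descends_def using X Y assms(2,3) by blast
    then show ?thesis ..
  qed
qed

lemma descendsE:
  assumes "descends X Y"
  obtains x M where "X = add_mset x M" "Y = add_mset (disc X - 3 * x) M"
    "(disc X - 2 * x) * (disc X - 4 * x) < 0"
proof -
  obtain x y M where X: "X = add_mset x M" and Y: "Y = add_mset y M" and less: "y\<^sup>2 < x\<^sup>2"
    and sol: "quadric X" "quadric Y"
    using assms unfolding descends_def by blast
  have y: "y = disc X - 3 * x" using quadric_replace sol less X Y by blast
  have "(disc X - 2 * x) * (disc X - 4 * x) = y\<^sup>2 - x\<^sup>2"
    unfolding y by (simp add: power2_eq_square algebra_simps)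
  then show thesis using that X Y y less by simp
qed

section \<open>Uniqueness of the lower neighbour\<close>

text \<open>By the sign condition u lies strictly between 2x and 4x. Multiplying by the mirror image
  under x -> -x turns this into squares, with no case split on the sign of x.\<close>

lemma steep_coordinate:
  assumes "quadric (add_mset x M)"
    and neg: "(disc (add_mset x M) - 2 * x) * (disc (add_mset x M) - 4 * x) < 0"
  shows "(disc (add_mset x M))\<^sup>2 < 16 * x\<^sup>2"
proof -
  define u where "u = disc (add_mset x M)"
  have "(\<Sum>x\<in>#M. x\<^sup>2) \<ge> 0" by (rule sum_mset_squares_nonneg)
  then have "8 * x\<^sup>2 < u\<^sup>2"
    using assms(1) unfolding quadric_def u_def by simp
  then have gap: "4 * x\<^sup>2 < u\<^sup>2" using zero_le_power2[of x] by linarith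
  have neg': "(u - 2 * x) * (u - 4 * x) < 0" using neg by (simp add: u_def)
  \<comment> \<open>Only the cross term can make this negative, so u * x > 0; the mirror product has
    the opposite cross term and is positive.\<close>
  have "(u - 2 * x) * (u - 4 * x) = u\<^sup>2 + 8 * x\<^sup>2 - 6 * (u * x)"
    by (simp add: power2_eq_square algebra_simps)
  then have "u * x > 0"
    using neg' zero_le_power2[of u] zero_le_power2[of x] by linarith
  moreover have "(u + 2 * x) * (u + 4 * x) = u\<^sup>2 + 8 * x\<^sup>2 + 6 * (u * x)"
    by (simp add: power2_eq_square algebra_simps)
  ultimately have "(u + 2 * x) * (u + 4 * x) > 0"
    using zero_le_power2[of u] zero_le_power2[of x] by linarith
  then have "((u - 2 * x) * (u - 4 * x)) * ((u + 2 * x) * (u + 4 * x)) < 0"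
    using neg' by (rule mult_neg_pos[rotated])
  moreover have "((u - 2 * x) * (u - 4 * x)) * ((u + 2 * x) * (u + 4 * x)) =
      (u\<^sup>2 - 4 * x\<^sup>2) * (u\<^sup>2 - 16 * x\<^sup>2)"
    by (simp add: power2_eq_square algebra_simps)
  ultimately have "u\<^sup>2 - 16 * x\<^sup>2 < 0"
    using gap by (simp add: mult_less_0_iff)
  then show ?thesis by (simp add: u_def)
qed

lemma descends_unique:
  assumes "descends X Y" "descends X Z"
  shows "Y = Z"
proof -
  obtain x M where X: "X = add_mset x M" and Y: "Y = add_mset (disc X - 3 * x) M"
    and x: "(disc X - 2 * x) * (disc X - 4 * x) < 0"
    using assms(1) by (rule descendsE)
  obtain z N where X': "X = add_mset z N" and Z: "Z = add_mset (disc X - 3 * z) N"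
    and z: "(disc X - 2 * z) * (disc X - 4 * z) < 0"
    using assms(2) by (rule descendsE)
  have sol: "quadric X" using assms(1) by (simp add: descends_def)
  \<comment> \<open>Equal values leave the same rest, hence the same neighbour, whichever copy is
    exchanged.\<close>
  have "x = z"
  proof (rule ccontr)
    assume "x \<noteq> z"
    then obtain K where "M = add_mset z K"
      using X X' by (auto simp: add_eq_conv_ex)
    then have sum: "(\<Sum>x\<in>#X. x\<^sup>2) = x\<^sup>2 + z\<^sup>2 + (\<Sum>x\<in>#K. x\<^sup>2)"
      using X by simp
    have "(\<Sum>x\<in>#K. x\<^sup>2) \<ge> 0" by (rule sum_mset_squares_nonneg)
    then have "8 * x\<^sup>2 + 8 * z\<^sup>2 < (disc X)\<^sup>2"
      using sol sum unfolding quadric_def by (simp add: algebra_simps)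
    moreover have "(disc X)\<^sup>2 < 16 * x\<^sup>2" "(disc X)\<^sup>2 < 16 * z\<^sup>2"
      using steep_coordinate[of x M] steep_coordinate[of z N] sol x z
      unfolding X[symmetric] X'[symmetric] by blast+
    \<comment> \<open>Averaging the last two bounds gives
      \<open>(disc X)\<^sup>2 < 8 * x\<^sup>2 + 8 * z\<^sup>2\<close>.\<close>
    ultimately show False by linarith
  qed
  then show ?thesis using X X' Y Z by simp
qed

section \<open>Reduced solutions and connected components\<close>

definition reduced :: "int multiset \<Rightarrow> bool" where
  "reduced X \<longleftrightarrow> (\<forall>Y. \<not> descends X Y)"

lemma reducedI:
  assumes "\<And>x. x \<in># X \<Longrightarrow> (disc X - 2 * x) * (disc X - 4 * x) \<ge> 0"
  shows "reduced X"
  unfolding reduced_def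
proof (intro allI notI)
  fix Y assume "descends X Y"
  then obtain x M where "X = add_mset x M" and lt: "(disc X - 2 * x) * (disc X - 4 * x) < 0"
    by (rule descendsE)
  then have "x \<in># X" by simp
  then show False using assms lt by fastforce
qed

text \<open>Induction along the path: a step up prepends one descent to the chain down to
  \<open>R\<close>; a step down must be the first link of that chain, by
  \<open>descends_unique\<close>.\<close>

lemma connected_to_reduced:
  assumes path: "(R, X) \<in> ({(X, Y). adjacent X Y} \<inter> V \<times> V)\<^sup>*"
    and "reduced R" and V: "\<And>X. X \<in> V \<Longrightarrow> quadric X"
  shows "descends\<^sup>*\<^sup>* X R"
  using path
proof (induction rule: rtrancl_induct)
  case base
  show ?case by simp
next
  case (step Y Z)
  then consider "descends Z Y" | "descends Y Z"
    using adjacent_descends V by blast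
  then show ?case
  proof cases
    case 1
    then show ?thesis using step.IH by (rule converse_rtranclp_into_rtranclp)
  next
    case 2
    \<comment> \<open>\<open>R\<close> has no descent, so the chain from \<open>Y\<close> is
      nonempty and starts with \<open>Z\<close>.\<close>
    then have "Y \<noteq> R" using \<open>reduced R\<close> by (auto simp: reduced_def)
    then obtain W where "descends Y W" "descends\<^sup>*\<^sup>* W R"
      using step.IH by (metis converse_rtranclpE)
    then show ?thesis using descends_unique 2 by blast
  qed
qed

lemma reduced_connected_eq:
  assumes "(R, S) \<in> ({(X, Y). adjacent X Y} \<inter> V \<times> V)\<^sup>*"
    and "reduced R" "reduced S" "\<And>X. X \<in> V \<Longrightarrow> quadric X"
  shows "R = S"
proof -
  have "descends\<^sup>*\<^sup>* S R" by (rule connected_to_reduced[OF assms(1,2,4)])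
  then show ?thesis
    using \<open>reduced S\<close> by (cases rule: converse_rtranclpE) (auto simp: reduced_def)
qed

lemma infinite_connected_components:
  fixes R :: "nat \<Rightarrow> int multiset"
  assumes "inj R" "\<And>m. R m \<in> V" "\<And>m. reduced (R m)" and V: "\<And>X. X \<in> V \<Longrightarrow> quadric X"
  shows "infinite (connected_components V)"
proof -
  define E where "E = ({(X, Y). adjacent X Y} \<inter> V \<times> V)\<^sup>* \<inter> V \<times> V"
  have "inj (\<lambda>m. E `` {R m})"
  proof (rule injI)
    fix k m assume "E `` {R k} = E `` {R m}"
    moreover have "R m \<in> E `` {R m}" using assms(2) by (simp add: E_def)
    ultimately have "(R k, R m) \<in> ({(X, Y). adjacent X Y} \<inter> V \<times> V)\<^sup>*"
      by (auto simp: E_def)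
    then have "R k = R m" using reduced_connected_eq assms(3) V by blast
    then show "k = m" using \<open>inj R\<close> by (simp add: inj_eq)
  qed
  then have "infinite (range (\<lambda>m. E `` {R m}))" by (simp add: finite_image_iff)
  moreover have "range (\<lambda>m. E `` {R m}) \<subseteq> connected_components V"
    using assms(2) by (auto simp: connected_components_def E_def[symmetric] intro: quotientI)
  ultimately show ?thesis using infinite_super by blast
qed

section \<open>Two infinite families of reduced solutions\<close>

text \<open>A pair b, b together with m, -m has 2q = s^2 + 4m^2, where s = 2b; so 2q = s^2 + s means
  b = 2m^2.\<close>

definition root_pos :: "nat \<Rightarrow> nat \<Rightarrow> int multiset" where
  "root_pos k m = {#- int m, int m, 2 * (int m)\<^sup>2, 2 * (int m)\<^sup>2#} + replicate_mset k 0"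

text \<open>Here m, -m - 1 add up to -1, and the equation forces N = m^2 + (m + 1)^2.\<close>

definition root_neg :: "nat \<Rightarrow> nat \<Rightarrow> int multiset" where
  "root_neg k m = (let N = 2 * (int m)\<^sup>2 + 2 * int m + 1
     in {#int m, - int m - 1, - N, - N#} + replicate_mset k 0)"

lemma disc_root_pos: "disc (root_pos k m) = 8 * (int m)\<^sup>2 + 1"
  by (simp add: disc_def root_pos_def)

lemma disc_root_neg: "disc (root_neg k m) = - 8 * (int m)\<^sup>2 - 8 * int m - 5"
  by (simp add: disc_def root_neg_def Let_def)

lemma quadric_root_pos: "quadric (root_pos k m)"
  unfolding quadric_def disc_root_pos
  by (simp add: root_pos_def power2_eq_square algebra_simps)

lemma quadric_root_neg: "quadric (root_neg k m)"
  unfolding quadric_def disc_root_neg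
  by (simp add: root_neg_def Let_def power2_eq_square algebra_simps)

lemma le_square_int: "int m \<le> (int m)\<^sup>2"
  unfolding power2_eq_square of_nat_mult[symmetric] of_nat_le_iff by (rule le_square)

lemma reduced_root_pos: "reduced (root_pos k m)"
proof (rule reducedI)
  fix x assume "x \<in># root_pos k m"
  then have "x = - int m \<or> x = int m \<or> x = 2 * (int m)\<^sup>2 \<or> x = 0"
    by (auto simp: root_pos_def split: if_splits)
  \<comment> \<open>The tightest case is x = 2m^2, where 4x is one less than
    \<open>disc\<close>.\<close>
  then have "disc (root_pos k m) - 2 * x \<ge> 0" "disc (root_pos k m) - 4 * x \<ge> 0"
    unfolding disc_root_pos using le_square_int[of m] by linarith+
  then show "(disc (root_pos k m) - 2 * x) * (disc (root_pos k m) - 4 * x) \<ge> 0"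
    by (rule mult_nonneg_nonneg)
qed

lemma reduced_root_neg: "reduced (root_neg k m)"
proof (rule reducedI)
  fix x assume "x \<in># root_neg k m"
  then have "x = int m \<or> x = - int m - 1 \<or> x = - (2 * (int m)\<^sup>2 + 2 * int m + 1) \<or> x = 0"
    by (auto simp: root_neg_def Let_def split: if_splits)
  \<comment> \<open>The tightest case is x = -N, where 4x is one more than
    \<open>disc\<close>.\<close>
  then have "disc (root_neg k m) - 2 * x \<le> 0" "disc (root_neg k m) - 4 * x \<le> 0"
    unfolding disc_root_neg using zero_le_power2[of "int m"] by linarith+
  then show "(disc (root_neg k m) - 2 * x) * (disc (root_neg k m) - 4 * x) \<ge> 0"
    by (rule mult_nonpos_nonpos)
qed

lemma inj_root_pos: "inj (root_pos k)"
proof (rule injI)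
  fix m m' assume "root_pos k m = root_pos k m'"
  then have "disc (root_pos k m) = disc (root_pos k m')" by (rule arg_cong)
  then have "(int m)\<^sup>2 = (int m')\<^sup>2" unfolding disc_root_pos by linarith
  then show "m = m'" by (simp add: power2_eq_iff_nonneg)
qed

lemma inj_root_neg: "inj (root_neg k)"
proof (rule injI)
  fix m m' assume "root_neg k m = root_neg k m'"
  then have "(int m)\<^sup>2 + int m = (int m')\<^sup>2 + int m'"
    using disc_root_neg[of k m] disc_root_neg[of k m'] by simp
  then have "(int m - int m') * (int m + int m' + 1) = 0"
    by (simp add: power2_eq_square algebra_simps)
  then show "m = m'" by auto
qed

theorem theorem4p8:
  fixes n :: nat
  assumes "n \<ge> 4"
  shows "infinite (connected_components (solutions_pos n))
       \<and> infinite (connected_components (solutions_neg n))"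
proof
  have "root_pos (n - 4) m \<in> solutions_pos n" for m
  proof -
    \<comment> \<open>As n >= 4, the truncated subtraction is exact.\<close>
    have "size (root_pos (n - 4) m) = n"
      using assms by (simp add: root_pos_def)
    moreover have "sum_mset (root_pos (n - 4) m) + 1 > 0"
      using disc_root_pos[of "n - 4" m] zero_le_power2[of "int m"]
      unfolding disc_def by linarith
    ultimately show ?thesis
      using quadric_root_pos by (simp add: solutions_pos_def solutions_eq)
  qed
  then show "infinite (connected_components (solutions_pos n))"
    by (intro infinite_connected_components[OF inj_root_pos])
      (auto simp: reduced_root_pos solutions_pos_def solutions_eq)
  have "root_neg (n - 4) m \<in> solutions_neg n" for m
  proof -
    have "size (root_neg (n - 4) m) = n"
      using assms by (simp add: root_neg_def Let_def)
    \<comment> \<open>\<open>disc\<close> is at most -5, so the sum is at most -3.\<close>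
    moreover have "sum_mset (root_neg (n - 4) m) + 1 < 0"
      using disc_root_neg[of "n - 4" m] zero_le_power2[of "int m"]
      unfolding disc_def by linarith
    ultimately show ?thesis
      using quadric_root_neg by (simp add: solutions_neg_def solutions_eq)
  qed
  then show "infinite (connected_components (solutions_neg n))"
    by (intro infinite_connected_components[OF inj_root_neg])
      (auto simp: reduced_root_neg solutions_neg_def solutions_eq)
qed

end
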